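(* Let $Q\subset\mathbb{R}^d$ be a quasilattice generated (as a $\mathbb{Z}$-module) by the vectors of a vector configuration $V=(v_1,\dots,v_n)$. Then its nonrationality degree is $$\deg_{\mathrm{NR}}Q=b(V)-(n-d).$$
   Context: A quasilattice in $\mathbb{R}^d$ is the $\mathbb{Z}$-span of a finite set of $\mathbb{R}$-generators of $\mathbb{R}^d$. Its nonrationality degree is $\deg_{\mathrm{NR}}Q=\dim_{\mathbb{R}}(\overline Q)^0$, where $(\overline Q)^0$ is the connected component containing $0$ of the closure $\overline Q\subseteq\mathbb{R}^d$ (a vector subspace of $\mathbb{R}^d$). A vector configuration is a finite list $V=(v_1,\dots,v_n)$ of vectors spanning $\mathbb{R}^d$ (repetitions allowed). Put $\mathrm{Rel}(V)=\{c\in\mathbb{R}^n:\sum_j c_jv_j=0\}$. A subspace $T\subseteq\mathbb{R}^n$ is rational if it is the real span of $T\cap\mathbb{Q}^n$. The rational envelope $W^{\mathbb{Q}}$ of a subspace $W\subseteq\mathbb{R}^n$ is the intersection of all rational subspaces containing $W$ (the smallest rational subspace containing $W$). Then $b(V)=\dim_{\mathbb{R}}\mathrm{Rel}(V)^{\mathbb{Q}}$. *)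

theory Defs
  imports "HOL-Analysis.Analysis"
begin

(* The integers act on a real vector space through of_int; the Z-span is the library's
   module span for this action. *)
definition int_span :: "'a::real_vector set \<Rightarrow> 'a set"
  where "int_span S = module.span (\<lambda>(k::int) x. of_int k *\<^sub>R x) S"

lemma module_int_scaleR: "module (\<lambda>(k::int) (x::'a::real_vector). of_int k *\<^sub>R x)"
  by standard (simp_all add: scaleR_right_distrib scaleR_left_distrib)

lemma int_span_explicit:
  "int_span S = {(\<Sum>a\<in>t. of_int (r a) *\<^sub>R a) | t (r :: _ \<Rightarrow> int). finite t \<and> t \<subseteq> S}"
  unfolding int_span_def by (rule module.span_explicit [OF module_int_scaleR])

definition quasilattice :: "(real ^ 'd) set \<Rightarrow> bool"
  where "quasilattice Q \<longleftrightarrow> (\<exists>S. finite S \<and> span S = UNIV \<and> Q = int_span S)"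

(* Applied to a general set, dim is the dimension of its linear span. For a quasilattice the
   component of 0 in the closure is itself a linear subspace, so this is its dimension. *)
definition deg_NR :: "(real ^ 'd) set \<Rightarrow> nat"
  where "deg_NR Q = dim (connected_component_set (closure Q) 0)"

(* A finite list (v_1, ..., v_n) is a family indexed by a finite type 'n with n = CARD('n);
   it need not be injective, so repetitions are allowed. *)
definition vector_configuration :: "('n::finite \<Rightarrow> real ^ 'd) \<Rightarrow> bool"
  where "vector_configuration v \<longleftrightarrow> span (range v) = UNIV"

definition Rel :: "('n::finite \<Rightarrow> real ^ 'd) \<Rightarrow> (real ^ 'n) set"
  where "Rel v = {c. (\<Sum>j\<in>UNIV. (c $ j) *\<^sub>R v j) = 0}"

definition rational_points :: "(real ^ 'n) set"
  where "rational_points = {x. \<forall>i. x $ i \<in> \<rat>}"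

definition rational_subspace :: "(real ^ 'n) set \<Rightarrow> bool"
  where "rational_subspace T \<longleftrightarrow> subspace T \<and> T = span (T \<inter> rational_points)"

definition rational_envelope :: "(real ^ 'n) set \<Rightarrow> (real ^ 'n) set"
  where "rational_envelope W = \<Inter>{T. rational_subspace T \<and> W \<subseteq> T}"

definition rel_envelope_dim :: "('n::finite \<Rightarrow> real ^ 'd) \<Rightarrow> nat"
  where "rel_envelope_dim v = dim (rational_envelope (Rel v))"

end

theory Submission
  imports Defs
begin

text \<open>Let \<open>\<phi>\<close> send \<open>c\<close> to \<open>\<Sum>j. c\<^sub>j v\<^sub>j\<close>, and let \<open>M\<close> be the largest linear subspace of the closure of \<open>Q\<close>.
  The closure of \<open>Q\<close> modulo \<open>M\<close> is discrete, so a pigeonhole argument shows that the preimage of \<open>M\<close>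
  under \<open>\<phi>\<close> is rational; it contains the relations, hence their rational envelope \<open>E\<close>. Conversely, if \<open>T\<close> is a
  rational subspace containing the relations, then a functional that vanishes on \<open>T\<close> and is integral on
  integer points descends to a functional that is integral on \<open>Q\<close>, and therefore zero on the component
  of \<open>0\<close> in the closure. So this component is \<open>\<phi>(E)\<close>, and the formula is the rank-nullity theorem.\<close>

section \<open>Discrete subgroups and rationality of kernels\<close>

interpretation int_mod: module "\<lambda>(k::int) (x::'a::real_vector). of_int k *\<^sub>R x"
  by (rule module_int_scaleR)

text \<open>A \<int>-submodule is the same as an additive subgroup. Isolation of 0 alone suffices
  for discreteness, since differences stay in the group.\<close>

definition discrete_subgroup :: "'a::real_normed_vector set \<Rightarrow> bool"
  where "discrete_subgroup D \<longleftrightarrow>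
    int_mod.subspace D \<and> (\<exists>e>0. \<forall>x\<in>D. norm x < e \<longrightarrow> x = 0)"

text \<open>Pigeonhole: the fractional parts of the multiples of a vector form a bounded sequence
  in the discrete group, so two of them coincide.\<close>

lemma discrete_subgroup_coordinates_Rats:
  fixes D :: "'a::euclidean_space set"
  assumes D: "discrete_subgroup D" and B: "finite B" "independent B" "B \<subseteq> D"
    and x: "(\<Sum>b\<in>B. r b *\<^sub>R b) \<in> D" and b: "b \<in> B"
  shows "r b \<in> \<rat>"
proof -
  from D obtain e where sub: "int_mod.subspace D" and "e > 0"
    and e: "\<And>x. x \<in> D \<Longrightarrow> norm x < e \<Longrightarrow> x = 0"
    unfolding discrete_subgroup_def by blast
  \<comment> \<open>Reducing the coordinates of the \<open>m\<close>-th multiple modulo 1 subtracts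
    an integer combination of \<open>B\<close>, so \<open>y m\<close> stays in \<open>D\<close>
    while remaining bounded.\<close>
  define y where "y m = (\<Sum>b\<in>B. frac (real m * r b) *\<^sub>R b)" for m
  have y_eq: "y m = of_int (int m) *\<^sub>R (\<Sum>b\<in>B. r b *\<^sub>R b) - (\<Sum>b\<in>B. of_int \<lfloor>real m * r b\<rfloor> *\<^sub>R b)" for m
    by (simp add: y_def frac_def scaleR_sum_right algebra_simps sum_subtractf)
  have yD: "y m \<in> D" for m
    unfolding y_eq using B(3)
    by (intro int_mod.subspace_diff[OF sub] int_mod.subspace_scale[OF sub x]
        int_mod.subspace_sum[OF sub] int_mod.subspace_scale[OF sub]) auto
  have "norm (y m) \<le> (\<Sum>b\<in>B. norm b)" for m
    unfolding y_def
  proof (rule sum_norm_le)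
    fix b
    have "\<bar>frac (real m * r b)\<bar> \<le> 1"
      using frac_lt_1[of "real m * r b"] frac_ge_0[of "real m * r b"] by linarith
    then show "norm (frac (real m * r b) *\<^sub>R b) \<le> norm b"
      by (simp add: mult_left_le_one_le)
  qed
  then have "bounded (range y)"
    by (auto simp: bounded_iff)
  \<comment> \<open>Pigeonhole in the form of compactness: terms of a Cauchy subsequence that are
    closer than \<open>e\<close> must be equal, by discreteness.\<close>
  then obtain l s where s: "strict_mono s" and "(y \<circ> s) \<longlonglongrightarrow> l"
    using bounded_imp_convergent_subsequence by blast
  then have "Cauchy (y \<circ> s)"
    using LIMSEQ_imp_Cauchy by blast
  then obtain N where N: "\<And>m n. m \<ge> N \<Longrightarrow> n \<ge> N \<Longrightarrow> norm (y (s m) - y (s n)) < e"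
    using \<open>e > 0\<close> unfolding Cauchy_iff by fastforce
  have "y (s N) - y (s (Suc N)) = 0"
    using N[of N "Suc N"] yD sub by (intro e int_mod.subspace_diff) auto
  then have "(\<Sum>b\<in>B. (frac (real (s N) * r b) - frac (real (s (Suc N)) * r b)) *\<^sub>R b) = 0"
    by (simp add: y_def scaleR_diff_left sum_subtractf)
  then have fr: "frac (real (s N) * r b) = frac (real (s (Suc N)) * r b)"
    using independentD[OF B(2,1) order_refl _ b, of "\<lambda>b. frac (real (s N) * r b) - frac (real (s (Suc N)) * r b)"] by simp
  \<comment> \<open>Equal fractional parts make a nonzero integer multiple of \<open>r b\<close> an
    integer; the strict inequality keeps the denominator away from 0.\<close>
  have lt: "s N < s (Suc N)" using s by (simp add: strict_mono_def)
  have "(real (s (Suc N)) - real (s N)) * r b = of_int (\<lfloor>real (s (Suc N)) * r b\<rfloor> - \<lfloor>real (s N) * r b\<rfloor>)"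
    using fr unfolding frac_def by (simp add: algebra_simps)
  then have "r b = of_int (\<lfloor>real (s (Suc N)) * r b\<rfloor> - \<lfloor>real (s N) * r b\<rfloor>) / (real (s (Suc N)) - real (s N))"
    using lt by (simp add: field_simps)
  also have "\<dots> \<in> \<rat>"
    by (intro Rats_divide Rats_diff Rats_of_int Rats_of_nat)
  finally show ?thesis .
qed

lemma vec_eq_sum_axis: "x = (\<Sum>i\<in>UNIV. (x $ i) *\<^sub>R axis i (1::real))"
  by (simp add: vec_eq_iff axis_def if_distrib cong: if_cong)

text \<open>With a basis \<open>B\<close> chosen among the images of the standard basis and lifted
  back to axis vectors by \<open>g\<close>, the map \<open>k\<close> is a projection onto the
  kernel. Images of axis vectors have rational coordinates in \<open>B\<close>, so \<open>k\<close>
  sends axis vectors to rational points, and these span the kernel.\<close>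

lemma rational_subspace_kernel:
  fixes f :: "real ^ 'n \<Rightarrow> 'a::euclidean_space"
  assumes f: "linear f" and D: "discrete_subgroup D" and fD: "\<And>i. f (axis i 1) \<in> D"
  shows "rational_subspace {c. f c = 0}"
proof -
  define K where "K = {c. f c = 0}"
  have K: "subspace K" unfolding K_def using f by (rule linear_subspace_kernel)
  define A where "A = range (\<lambda>i. f (axis i 1))"
  obtain B where B: "B \<subseteq> A" "independent B" "A \<subseteq> span B"
    using maximal_independent_subset[of A] by blast
  have finB: "finite B" by (rule finite_subset[OF B(1)]) (simp add: A_def)
  define j where "j b = (SOME i. f (axis i 1) = b)" for b
  have j: "f (axis (j b) 1) = b" if "b \<in> B" for b
    using that B(1) unfolding A_def j_def by (auto intro: someI)
  obtain g where g: "linear g" "\<And>b. b \<in> B \<Longrightarrow> g b = axis (j b) (1::real)"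
    using linear_independent_extend[OF B(2), of "\<lambda>b. axis (j b) 1"] by blast
  have fg: "f (g y) = y" if "y \<in> span B" for y
  proof -
    have "(f \<circ> g) y = id y"
      using linear_compose[OF g(1) f] linear_id that
      by (rule linear_eq_on) (simp add: g(2) j)
    then show ?thesis by simp
  qed
  define k where "k c = c - g (f c)" for c
  have lk: "linear k"
    unfolding k_def using linear_compose[OF f g(1)] by (intro linear_compose_sub linear_ident) (simp add: o_def)
  have kax: "k (axis i 1) \<in> K \<inter> rational_points" for i
  proof
    have sp: "f (axis i 1) \<in> span B" using B(3) by (auto simp: A_def)
    show "k (axis i 1) \<in> K"
      using fg[OF sp] by (simp add: K_def k_def linear_diff[OF f])
    obtain r where r: "f (axis i 1) = (\<Sum>b\<in>B. r b *\<^sub>R b)"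
      using sp finB by (auto simp: span_finite)
    have rat: "r b \<in> \<rat>" if "b \<in> B" for b
      using discrete_subgroup_coordinates_Rats[OF D finB B(2) _ _ that, of r] r fD[of i] B(1) fD
      by (auto simp: A_def)
    have "g (f (axis i 1)) = (\<Sum>b\<in>B. r b *\<^sub>R axis (j b) 1)"
      unfolding r using g by (simp add: linear_sum linear_scale)
    then show "k (axis i 1) \<in> rational_points"
      using rat by (auto simp: rational_points_def k_def axis_def intro!: Rats_diff Rats_sum Rats_mult)
  qed
  have "K \<subseteq> span (K \<inter> rational_points)"
  proof
    fix c assume "c \<in> K"
    then have "c = k c"
      by (simp add: K_def k_def linear_0[OF g(1)])
    also have "k c = (\<Sum>i\<in>UNIV. (c $ i) *\<^sub>R k (axis i 1))"
      by (subst vec_eq_sum_axis[of c]) (simp add: linear_sum[OF lk] linear_scale[OF lk])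
    also have "\<dots> \<in> span (K \<inter> rational_points)"
      by (intro span_sum span_scale span_base kax)
    finally show "c \<in> span (K \<inter> rational_points)" .
  qed
  moreover have "span (K \<inter> rational_points) \<subseteq> K"
    using K by (simp add: span_minimal)
  ultimately show ?thesis
    using K unfolding rational_subspace_def K_def by blast
qed

section \<open>Integer points and separating functionals of rational subspaces\<close>

definition integer_points :: "(real ^ 'n) set"
  where "integer_points = {x. \<forall>i. x $ i \<in> \<int>}"

lemma discrete_subgroup_integer_points: "discrete_subgroup (integer_points :: (real ^ 'n) set)"
  unfolding discrete_subgroup_def
proof (intro conjI exI[of _ 1] ballI impI)
  show "int_mod.subspace (integer_points :: (real ^ 'n) set)"
    by (auto simp: int_mod.subspace_def integer_points_def intro!: Ints_mult)
  fix x :: "real ^ 'n" assume x: "x \<in> integer_points" "norm x < 1"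
  have "x $ i = 0" for i
  proof -
    have "\<bar>x $ i\<bar> < 1" using x(2) component_le_norm_cart[of x i] by linarith
    moreover have "x $ i \<in> \<int>" using x(1) by (simp add: integer_points_def)
    ultimately show ?thesis using Ints_nonzero_abs_less1 by blast
  qed
  then show "x = 0" by (simp add: vec_eq_iff)
qed auto

lemma rational_point_scaled_integer:
  fixes x :: "real ^ 'n::finite"
  assumes "x \<in> rational_points"
  obtains N :: int where "N > 0" "of_int N *\<^sub>R x \<in> integer_points"
proof -
  have "\<exists>q p. x $ i = of_int p / of_int q \<and> q > (0::int)" for i
    using assms Rats_cases'[of "x $ i"] unfolding rational_points_def by (metis mem_Collect_eq)
  then obtain p q where pq: "\<And>i. x $ i = of_int (p i) / of_int (q i)" "\<And>i. q i > (0::int)"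
    by metis
  define N where "N = (\<Prod>i\<in>UNIV. q i)"
  show ?thesis
  proof
    show "N > 0" unfolding N_def using pq(2) by (simp add: prod_pos)
    have "of_int N * x $ i \<in> \<int>" for i
    proof -
      have "q i dvd N" unfolding N_def by (simp add: dvd_prodI)
      then obtain m where "N = q i * m" by blast
      then show ?thesis using pq(1)[of i] pq(2)[of i] by simp
    qed
    then show "of_int N *\<^sub>R x \<in> integer_points" by (simp add: integer_points_def)
  qed
qed

text \<open>Clearing denominators rescales each rational spanning vector to an integral one without
  changing its line.\<close>

lemma rational_subspace_eq_span_integer_points:
  assumes "rational_subspace T"
  shows "T = span (T \<inter> integer_points)"
proof
  have T: "subspace T" "T = span (T \<inter> rational_points)"
    using assms by (auto simp: rational_subspace_def)
  show "span (T \<inter> integer_points) \<subseteq> T" using T(1) by (simp add: span_minimal)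
  have "x \<in> span (T \<inter> integer_points)" if x: "x \<in> T" "x \<in> rational_points" for x
  proof -
    obtain N :: int where N: "N > 0" "of_int N *\<^sub>R x \<in> integer_points"
      using rational_point_scaled_integer[OF x(2)] .
    have "of_int N *\<^sub>R x \<in> span (T \<inter> integer_points)"
      using N(2) T(1) x(1) by (intro span_base) (simp add: subspace_scale)
    then have "inverse (of_int N) *\<^sub>R (of_int N *\<^sub>R x) \<in> span (T \<inter> integer_points)"
      by (rule span_scale)
    then show ?thesis using N(1) by simp
  qed
  then have "span (T \<inter> rational_points) \<subseteq> span (T \<inter> integer_points)"
    by (intro span_minimal) auto
  then show "T \<subseteq> span (T \<inter> integer_points)" using T(2) by simp
qed

text \<open>The functionals are coordinates with respect to an integral basis of the whole space that
  extends one of the subspace.\<close>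

lemma rational_subspace_separation:
  fixes T :: "(real ^ 'n) set"
  assumes T: "rational_subspace T" and x: "x \<notin> T"
  obtains h :: "real ^ 'n \<Rightarrow> real"
  where "linear h" "\<forall>y\<in>T. h y = 0" "\<forall>z\<in>integer_points. h z \<in> \<int>" "h x \<noteq> 0"
proof -
  obtain B where B: "B \<subseteq> T \<inter> integer_points" "independent B" "T \<inter> integer_points \<subseteq> span B"
    using maximal_independent_subset[of "T \<inter> integer_points"] by blast
  have TB: "T = span B"
    using rational_subspace_eq_span_integer_points[OF T] B span_mono[OF B(1)] span_minimal[OF B(3) subspace_span]
    by auto
  obtain C where C: "B \<subseteq> C" "C \<subseteq> integer_points" "independent C" "integer_points \<subseteq> span C"
    using maximal_independent_subset_extend[of B integer_points] B by blast
  have finC: "finite C" using C(3) by (rule independent_imp_finite)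
  have ax: "axis i 1 \<in> integer_points" for i :: 'n
    by (simp add: integer_points_def axis_def)
  have spC: "span C = UNIV"
  proof -
    have "y \<in> span C" for y :: "real ^ 'n"
      by (subst vec_eq_sum_axis) (use C(4) ax in \<open>auto intro!: span_sum span_scale\<close>)
    then show ?thesis by auto
  qed
  define rep where "rep = real_vector.representation C"
  have rep_sum: "(\<Sum>c\<in>C. rep y c *\<^sub>R c) = y" for y
    unfolding rep_def using C(3) spC finC by (intro real_vector.sum_representation_eq) auto
  \<comment> \<open>If all coordinates outside \<open>B\<close> vanished, \<open>x\<close> would lie
    in the span of \<open>B\<close>, which is \<open>T\<close>. The coordinate at such an
    \<open>s\<close> separates \<open>x\<close> from \<open>T\<close>.\<close>
  have "\<exists>s\<in>C - B. rep x s \<noteq> 0"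
  proof (rule ccontr)
    assume *: "\<not> ?thesis"
    have "x = (\<Sum>c\<in>C. rep x c *\<^sub>R c)" by (simp add: rep_sum)
    also have "\<dots> \<in> span B"
      using * by (intro span_sum) (metis DiffI scaleR_zero_left span_base span_scale span_zero)
    finally show False using x TB by simp
  qed
  then obtain s where s: "s \<in> C" "s \<notin> B" "rep x s \<noteq> 0" by blast
  have scaleR_eq: "(scaleR :: real \<Rightarrow> real \<Rightarrow> real) = (*)"
    by (simp add: fun_eq_iff)
  have lin: "linear (\<lambda>y. rep y s)"
    unfolding rep_def using real_vector.linear_representation[OF C(3) spC]
    by (simp add: linear_def scaleR_eq)
  \<comment> \<open>The vector \<open>w\<close> represents the coordinate functional at
    \<open>s\<close>. The basis \<open>C\<close> is integral but need not generate all integer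
    points over \<int>, so the entries of \<open>w\<close> are only rational; the factor
    \<open>N\<close> makes the functional integral.\<close>
  define w :: "real ^ 'n" where "w = (\<chi> i. rep (axis i 1) s)"
  have "w \<in> rational_points"
    unfolding rational_points_def w_def
    using discrete_subgroup_coordinates_Rats[OF discrete_subgroup_integer_points finC C(3,2) _ s(1)] ax
    by (simp add: rep_sum)
  then obtain N :: int where N: "N > 0" "of_int N *\<^sub>R w \<in> integer_points"
    by (rule rational_point_scaled_integer)
  show ?thesis
  proof
    show "linear (\<lambda>y. of_int N *\<^sub>R rep y s)" using lin by (rule linear_compose_scale_right)
    show "\<forall>y\<in>T. of_int N *\<^sub>R rep y s = 0"
    proof
      fix y assume "y \<in> T"
      then have y: "y \<in> span B" by (subst TB[symmetric])
      have "rep b s = 0" if "b \<in> B" for b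
        using that C(1) s(2) real_vector.representation_basis[OF C(3), of b]
        unfolding rep_def by auto
      then have "rep y s = 0" by (rule linear_eq_0_on_span[OF lin _ y])
      then show "of_int N *\<^sub>R rep y s = 0" by simp
    qed
    show "of_int N *\<^sub>R rep x s \<noteq> 0" using N(1) s(3) by simp
    show "\<forall>z\<in>integer_points. of_int N *\<^sub>R rep z s \<in> \<int>"
    proof
      fix z :: "real ^ 'n" assume z: "z \<in> integer_points"
      have "rep z s = (\<Sum>i\<in>UNIV. z $ i * w $ i)"
        by (subst vec_eq_sum_axis[of z]) (simp add: linear_sum[OF lin] linear_scale[OF lin] w_def)
      then have "of_int N *\<^sub>R rep z s = (\<Sum>i\<in>UNIV. z $ i * (of_int N * w $ i))"
        by (simp add: sum_distrib_left algebra_simps)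
      also have "\<dots> \<in> \<int>"
        using z N(2) by (intro Ints_sum Ints_mult[of "z $ _"]) (simp_all add: integer_points_def)
      finally show "of_int N *\<^sub>R rep z s \<in> \<int>" .
    qed
  qed
qed

section \<open>Closed subgroups modulo their largest linear subspace\<close>

text \<open>Integer multiples of the short vector \<open>x k\<close> hit every point of its line up
  to an error of at most \<open>norm (x k)\<close>. As these errors tend to 0 and the directions to
  \<open>u\<close>, closedness puts the whole line through \<open>u\<close> into
  \<open>W\<close>.\<close>

lemma closed_subgroup_limit_direction:
  fixes W :: "'a::real_normed_vector set"
  assumes W: "int_mod.subspace W" "closed W"
    and x: "\<And>k. x k \<in> W" "\<And>k. x k \<noteq> 0" "x \<longlonglongrightarrow> 0"
    and u: "(\<lambda>k. x k /\<^sub>R norm (x k)) \<longlonglongrightarrow> u"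
  shows "t *\<^sub>R u \<in> W"
proof -
  \<comment> \<open>Rounding down makes \<open>c k\<close> times the unit direction an integer
    multiple of \<open>x k\<close>, while \<open>c k\<close> still tends to
    \<open>t\<close>.\<close>
  define c where "c k = of_int \<lfloor>t / norm (x k)\<rfloor> * norm (x k)" for k
  have "norm (c k - t) \<le> norm (x k)" for k
  proof -
    have pos: "norm (x k) > 0" using x(2) by simp
    have "of_int \<lfloor>t / norm (x k)\<rfloor> \<le> t / norm (x k)" "t / norm (x k) \<le> of_int \<lfloor>t / norm (x k)\<rfloor> + 1"
      by linarith+
    then show ?thesis
      using pos mult_left_mono[of "of_int \<lfloor>t / norm (x k)\<rfloor>" "t / norm (x k)" "norm (x k)"]
        by (simp add: c_def field_simps abs_le_iff)
  qed
  then have "(\<lambda>k. c k - t) \<longlonglongrightarrow> 0"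
    using tendsto_norm_zero[OF x(3)] by (rule Lim_null_comparison[OF always_eventually[OF allI]])
  then have "c \<longlonglongrightarrow> t" by (simp add: LIM_zero_iff)
  then have lim: "(\<lambda>k. c k *\<^sub>R (x k /\<^sub>R norm (x k))) \<longlonglongrightarrow> t *\<^sub>R u"
    using u by (rule tendsto_scaleR)
  have "c k *\<^sub>R (x k /\<^sub>R norm (x k)) \<in> W" for k
    using int_mod.subspace_scale[OF W(1) x(1)] x(2) by (simp add: c_def mult.assoc)
  then show ?thesis by (rule closed_sequentially[OF W(2) _ lim])
qed

text \<open>For an additive subgroup \<open>W\<close> this is the largest linear subspace contained
  in \<open>W\<close>.\<close>

definition lineality_space :: "'a::real_vector set \<Rightarrow> 'a set"
  where "lineality_space W = {x. \<forall>t. t *\<^sub>R x \<in> W}"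

lemma subspace_lineality_space:
  assumes "int_mod.subspace W"
  shows "subspace (lineality_space W)"
  using int_mod.subspace_0[OF assms] int_mod.subspace_add[OF assms]
  by (auto simp: subspace_def lineality_space_def scaleR_add_right)

lemma lineality_space_subset: "lineality_space W \<subseteq> W"
proof
  fix x assume "x \<in> lineality_space W"
  then have "1 *\<^sub>R x \<in> W" unfolding lineality_space_def by blast
  then show "x \<in> W" by simp
qed

text \<open>The witness is the orthogonal projection onto the complement of \<open>M\<close>,
  obtained by subtracting the expansion in an orthonormal basis of \<open>M\<close>.\<close>

lemma subspace_linear_projection:
  fixes M :: "'a::euclidean_space set"
  assumes "subspace M"
  obtains p where "linear p" "{x. p x = 0} = M" "\<And>x. p x - x \<in> M"
proof -
  obtain B where B: "B \<subseteq> M" "pairwise orthogonal B" "\<And>x. x \<in> B \<Longrightarrow> norm x = 1"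
      "independent B" "span B = M"
    using orthonormal_basis_subspace[OF assms] by metis
  have fin: "finite B" using B(4) by (rule independent_imp_finite)
  define p where "p x = x - (\<Sum>b\<in>B. (x \<bullet> b) *\<^sub>R b)" for x
  have lin: "linear p"
    by (rule linearI) (simp_all add: p_def inner_simps algebra_simps sum.distrib scaleR_sum_right)
  have sumM: "(\<Sum>b\<in>B. (x \<bullet> b) *\<^sub>R b) \<in> M" for x
    using B(1) assms by (intro subspace_sum subspace_scale) auto
  have "p c = 0" if "c \<in> B" for c
  proof -
    have "(\<Sum>b\<in>B. (c \<bullet> b) *\<^sub>R b) = (\<Sum>b\<in>B. if b = c then c else 0)"
    proof (rule sum.cong[OF refl])
      fix b assume "b \<in> B"
      then show "(c \<bullet> b) *\<^sub>R b = (if b = c then c else 0)"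
        using B(2) B(3)[OF that] that
        by (auto simp: pairwise_def orthogonal_def dot_square_norm)
    qed
    then show ?thesis using that fin by (simp add: p_def)
  qed
  then have pM: "p x = 0" if "x \<in> M" for x
    using linear_eq_0_on_span[OF lin, of B x] that B(5) by blast
  show ?thesis
  proof
    show "linear p" by (rule lin)
    show "p x - x \<in> M" for x
      using subspace_neg[OF assms sumM] by (simp add: p_def)
    have "x \<in> M" if "p x = 0" for x
      using that sumM[of x] by (simp add: p_def)
    then show "{x. p x = 0} = M" using pM by blast
  qed
qed

text \<open>If nonzero elements of the projected group came arbitrarily close to 0, their unit
  directions would accumulate at some \<open>u\<close> whose line lies in \<open>W\<close>, so
  \<open>p u = 0\<close>. But \<open>p\<close> fixes these directions, hence also \<open>u\<close>,
  which contradicts \<open>norm u = 1\<close>.\<close>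

lemma closed_subgroup_mod_lineality_space:
  fixes W :: "'a::euclidean_space set"
  assumes W: "int_mod.subspace W" "closed W"
  obtains p :: "'a \<Rightarrow> 'a"
  where "linear p" "{y. p y = 0} = lineality_space W" "discrete_subgroup (p ` W)"
proof -
  define M where "M = lineality_space W"
  have M: "subspace M" "M \<subseteq> W"
    unfolding M_def using W(1) by (rule subspace_lineality_space) (rule lineality_space_subset)
  obtain p where p: "linear p" "{x. p x = 0} = M" "\<And>x. p x - x \<in> M"
    using subspace_linear_projection[OF M(1)] by blast
  have idem: "p (p x) = p x" for x
  proof -
    have "p (p x - x) = 0" using p(2,3) by blast
    then show ?thesis by (simp add: linear_diff[OF p(1)])
  qed
  have pW: "p x \<in> W" if "x \<in> W" for x
    using int_mod.subspace_add[OF W(1) that, of "p x - x"] p(3) M(2) by auto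
  have sub: "int_mod.subspace (p ` W)"
    using W(1) linear_add[OF p(1), symmetric] linear_scale[OF p(1), symmetric] linear_0[OF p(1), symmetric]
    by (auto simp: int_mod.subspace_def)
  have "\<exists>e>0. \<forall>x\<in>p ` W. norm x < e \<longrightarrow> x = 0"
  proof (rule ccontr)
    assume "\<not> ?thesis"
    then have "\<forall>k. \<exists>x. x \<in> p ` W \<and> norm x < inverse (real (Suc k)) \<and> x \<noteq> 0"
      by (metis inverse_positive_iff_positive of_nat_0_less_iff zero_less_Suc)
    then obtain x where x: "\<And>k. x k \<in> p ` W" "\<And>k. norm (x k) < inverse (real (Suc k))" "\<And>k. x k \<noteq> 0"
      by metis
    have x0: "x \<longlonglongrightarrow> 0"
      using x(2) by (intro Lim_null_comparison[OF _ LIMSEQ_inverse_real_of_nat] always_eventually)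
        (auto intro: less_imp_le)
    define y where "y k = x k /\<^sub>R norm (x k)" for k
    have ny: "norm (y k) = 1" for k using x(3) by (simp add: y_def)
    then have "bounded (range y)" by (auto simp: bounded_iff intro!: exI[of _ 1])
    then obtain u s where s: "strict_mono s" and u: "(y \<circ> s) \<longlonglongrightarrow> u"
      using bounded_imp_convergent_subsequence by blast
    have "t *\<^sub>R u \<in> W" for t
    proof (rule closed_subgroup_limit_direction[OF W, of "x \<circ> s"])
      show "(x \<circ> s) \<longlonglongrightarrow> 0" using x0 s by (rule LIMSEQ_subseq_LIMSEQ)
      show "(\<lambda>k. (x \<circ> s) k /\<^sub>R norm ((x \<circ> s) k)) \<longlonglongrightarrow> u" using u by (simp add: y_def o_def)
      show "(x \<circ> s) k \<in> W" "(x \<circ> s) k \<noteq> 0" for k using x(1)[of "s k"] x(3) pW by auto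
    qed
    then have "u \<in> M" by (simp add: M_def lineality_space_def)
    then have "p u = 0" using p(2) by blast
    have "p (x k) = x k" for k using x(1)[of k] idem by auto
    then have py: "p (y k) = y k" for k by (simp add: y_def linear_scale[OF p(1)])
    have "(\<lambda>k. p ((y \<circ> s) k)) \<longlonglongrightarrow> p u"
      using linear_continuous_at[of p u] p(1) u
      by (intro isCont_tendsto_compose[of u p]) (simp_all add: linear_linear o_def)
    then have "(y \<circ> s) \<longlonglongrightarrow> 0" using py \<open>p u = 0\<close> by (simp add: o_def)
    then have "u = 0" by (rule LIMSEQ_unique[OF u])
    moreover have "norm u = 1"
    proof (rule LIMSEQ_unique)
      show "(\<lambda>k. norm ((y \<circ> s) k)) \<longlonglongrightarrow> norm u" using u by (rule tendsto_norm)
      show "(\<lambda>k. norm ((y \<circ> s) k)) \<longlonglongrightarrow> 1" using ny by simp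
    qed
    ultimately show False by simp
  qed
  then show ?thesis
    using that[of p] p(1,2) sub unfolding discrete_subgroup_def M_def by simp
qed

lemma int_subspace_closure:
  fixes Q :: "'a::real_normed_vector set"
  assumes "int_mod.subspace Q"
  shows "int_mod.subspace (closure Q)"
  unfolding int_mod.subspace_def
proof (intro conjI ballI allI)
  show "0 \<in> closure Q"
    using int_mod.subspace_0[OF assms] closure_subset by blast
  fix x assume "x \<in> closure Q"
  then obtain f where f: "\<And>n. f n \<in> Q" "f \<longlonglongrightarrow> x"
    unfolding closure_sequential by blast
  {
    fix y assume "y \<in> closure Q"
    then obtain g where g: "\<And>n. g n \<in> Q" "g \<longlonglongrightarrow> y"
      unfolding closure_sequential by blast
    then show "x + y \<in> closure Q"
      unfolding closure_sequential using tendsto_add[OF f(2) g(2)] int_mod.subspace_add[OF assms f(1) g(1)]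
      by (intro exI[of _ "\<lambda>n. f n + g n"]) simp
  }
  fix k :: int
  show "of_int k *\<^sub>R x \<in> closure Q"
    unfolding closure_sequential
    using tendsto_scaleR[OF tendsto_const f(2), of "of_int k"] int_mod.subspace_scale[OF assms f(1)]
    by (intro exI[of _ "\<lambda>n. of_int k *\<^sub>R f n"]) simp
qed

section \<open>The linear combination map of a configuration\<close>

lemma linear_lincomb:
  fixes v :: "'n::finite \<Rightarrow> 'a::real_vector"
  shows "linear (\<lambda>c::real ^ 'n. \<Sum>j\<in>UNIV. (c $ j) *\<^sub>R v j)"
  by (rule linearI) (simp_all add: scaleR_left_distrib sum.distrib scaleR_sum_right)

lemma lincomb_axis:
  fixes v :: "'n::finite \<Rightarrow> 'a::real_vector"
  shows "(\<Sum>j\<in>UNIV. (axis i (1::real) $ j) *\<^sub>R v j) = v i"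
  by (simp add: axis_def if_distrib[of "\<lambda>a. a *\<^sub>R _"] cong: if_cong)

lemma surj_lincomb:
  fixes v :: "'n::finite \<Rightarrow> real ^ 'd"
  assumes "vector_configuration v"
  shows "surj (\<lambda>c::real ^ 'n. \<Sum>j\<in>UNIV. (c $ j) *\<^sub>R v j)" (is "surj ?phi")
proof -
  have "v i \<in> range ?phi" for i by (rule range_eqI[of _ _ "axis i 1"]) (simp add: lincomb_axis)
  then have "span (range v) \<subseteq> range ?phi"
    by (intro span_minimal) (auto intro: linear_subspace_image linear_lincomb)
  then show ?thesis using assms unfolding vector_configuration_def by auto
qed

text \<open>Presents the quasilattice as a linear image of the standard lattice, so that integrality
  on it can be tested on integer points.\<close>

lemma int_span_range:
  fixes v :: "'n::finite \<Rightarrow> 'a::real_vector"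
  shows "int_span (range v) = (\<lambda>c. \<Sum>j\<in>UNIV. (c $ j) *\<^sub>R v j) ` integer_points" (is "_ = ?phi ` _")
proof
  show "int_span (range v) \<subseteq> ?phi ` integer_points"
    unfolding int_span_def
  proof (rule int_mod.span_minimal)
    have "v i = ?phi (axis i 1)" "axis i (1::real) \<in> integer_points" for i
      using lincomb_axis[of i v] by (auto simp: integer_points_def axis_def)
    then show "range v \<subseteq> ?phi ` integer_points" by blast
    have Z: "int_mod.subspace (integer_points :: (real ^ 'n) set)"
      using discrete_subgroup_integer_points[where 'n = 'n] by (simp add: discrete_subgroup_def)
    show "int_mod.subspace (?phi ` integer_points)"
      unfolding int_mod.subspace_def
    proof (intro conjI ballI allI; (elim imageE)?)
      show "0 \<in> ?phi ` integer_points"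
        using int_mod.subspace_0[OF Z] by (rule rev_image_eqI) simp
    next
      fix x y a b assume "x = ?phi a" "y = ?phi b" "a \<in> integer_points" "b \<in> integer_points"
      then show "x + y \<in> ?phi ` integer_points"
        by (intro image_eqI[of _ _ "a + b"] int_mod.subspace_add[OF Z])
          (simp_all add: scaleR_left_distrib sum.distrib)
    next
      fix x a k assume "x = ?phi a" "a \<in> integer_points"
      then show "of_int k *\<^sub>R x \<in> ?phi ` integer_points"
        by (intro image_eqI[of _ _ "of_int k *\<^sub>R a"] int_mod.subspace_scale[OF Z])
          (simp_all add: scaleR_sum_right)
    qed
  qed
  show "?phi ` integer_points \<subseteq> int_span (range v)"
  proof clarify
    fix c :: "real ^ 'n" assume "c \<in> integer_points"
    then have "\<forall>j. \<exists>k. c $ j = of_int k" by (auto simp: integer_points_def Ints_def)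
    then obtain k where "\<And>j. c $ j = of_int (k j)" by metis
    then show "?phi c \<in> int_span (range v)"
      unfolding int_span_def
      by (simp add: int_mod.span_sum int_mod.span_scale int_mod.span_base)
  qed
qed

section \<open>The component of 0 and the dimension count\<close>

text \<open>A connected set with more than one point is uncountable, whereas \<int> is
  countable.\<close>

lemma connected_subset_Ints_eq:
  fixes S :: "real set"
  assumes "connected S" "S \<subseteq> \<int>" "x \<in> S" "y \<in> S"
  shows "x = y"
proof -
  have "S = {x}"
  proof (rule ccontr)
    assume "S \<noteq> {x}"
    then have "uncountable S" using connected_uncountable[OF assms(1,3)] assms(3) by blast
    then show False
      using assms(2) countable_subset[of S \<int>] by (simp add: Ints_def)
  qed
  then show ?thesis using assms(4) by blast
qed

text \<open>Rank-nullity on \<open>S\<close>: because \<open>S\<close> contains the kernel, the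
  section \<open>g\<close> splits it as the direct sum of the kernel and \<open>g\<close> f
  \<open>S\<close>.\<close>

lemma dim_linear_image_kernel:
  fixes f :: "'a::euclidean_space \<Rightarrow> 'b::euclidean_space"
  assumes f: "linear f" and g: "linear g" "\<And>y. f (g y) = y"
    and S: "subspace S" "{x. f x = 0} \<subseteq> S"
  shows "dim S = dim (f ` S) + dim {x. f x = 0}"
proof -
  let ?K = "{x. f x = 0}"
  have K: "subspace ?K" using f by (rule linear_subspace_kernel)
  have gS: "subspace (g ` f ` S)"
    using S(1) f g(1) by (simp add: linear_subspace_image)
  have ker: "x - g (f x) \<in> ?K" for x by (simp add: linear_diff[OF f] g(2))
  have "S = {x + y | x y. x \<in> ?K \<and> y \<in> g ` f ` S}"
  proof
    have "x = (x - g (f x)) + g (f x)" for x by simp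
    then show "S \<subseteq> {x + y | x y. x \<in> ?K \<and> y \<in> g ` f ` S}"
      using ker by blast
    have "g (f x) \<in> S" if "x \<in> S" for x
      using subspace_diff[OF S(1) that, of "x - g (f x)"] ker S(2) by auto
    then show "{x + y | x y. x \<in> ?K \<and> y \<in> g ` f ` S} \<subseteq> S"
      using S subspace_add[OF S(1)] by blast
  qed
  moreover have "?K \<inter> g ` f ` S = {0}"
    using g(2) linear_0[OF g(1)] linear_0[OF f] subspace_0[OF gS] by auto
  moreover have "dim (g ` f ` S) = dim (f ` S)"
    by (intro dim_image_eq[OF g(1)] inj_on_inverseI[of _ f] g(2))
  ultimately show ?thesis
    using dim_sums_Int[OF K gS] by simp
qed

lemma component_closure_eq_image:
  fixes v :: "'n::finite \<Rightarrow> real ^ 'd"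
  assumes v: "vector_configuration v"
  defines "\<phi> \<equiv> \<lambda>c::real ^ 'n. \<Sum>j\<in>UNIV. (c $ j) *\<^sub>R v j"
  shows "connected_component_set (closure (int_span (range v))) 0 = \<phi> ` rational_envelope (Rel v)"
proof
  define W where "W = closure (int_span (range v))"
  have \<phi>: "linear \<phi>" unfolding \<phi>_def by (rule linear_lincomb)
  have \<phi>_axis: "\<phi> (axis i 1) = v i" for i by (simp add: \<phi>_def lincomb_axis)
  have Rel: "Rel v = {c. \<phi> c = 0}" by (simp add: Rel_def \<phi>_def)
  have Q: "int_span (range v) = \<phi> ` integer_points" unfolding \<phi>_def by (rule int_span_range)
  have sub: "int_mod.subspace W" and "closed W"
    unfolding W_def int_span_def by (simp_all add: int_subspace_closure)
  have vW: "v i \<in> W" for i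
    unfolding W_def int_span_def by (rule subsetD[OF closure_subset], rule int_mod.span_base) simp

  show "\<phi> ` rational_envelope (Rel v) \<subseteq> connected_component_set (closure (int_span (range v))) 0"
  proof -
    obtain p :: "real ^ 'd \<Rightarrow> real ^ 'd"
      where p: "linear p" "{y. p y = 0} = lineality_space W" "discrete_subgroup (p ` W)"
      by (rule closed_subgroup_mod_lineality_space[OF sub \<open>closed W\<close>])
    have "rational_subspace {c. (p \<circ> \<phi>) c = 0}"
      by (rule rational_subspace_kernel[OF linear_compose[OF \<phi> p(1)] p(3)]) (simp add: \<phi>_axis vW)
    moreover have "Rel v \<subseteq> {c. (p \<circ> \<phi>) c = 0}"
      using linear_0[OF p(1)] by (auto simp: Rel)
    ultimately have "rational_envelope (Rel v) \<subseteq> {c. (p \<circ> \<phi>) c = 0}"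
      unfolding rational_envelope_def by blast
    then have "\<phi> ` rational_envelope (Rel v) \<subseteq> lineality_space W"
      using p(2) by auto
    also have "\<dots> \<subseteq> connected_component_set W 0"
      using subspace_lineality_space[OF sub] lineality_space_subset
      by (intro connected_component_maximal) (auto simp: subspace_0 subspace_imp_convex convex_connected)
    finally show ?thesis by (simp add: W_def)
  qed

  have "surj \<phi>"
    unfolding \<phi>_def using v by (rule surj_lincomb)
  then obtain g where g: "linear g" "\<And>y. \<phi> (g y) = y"
    using linear_surjective_right_inverse[OF \<phi>] by (metis comp_apply id_apply)

  show "connected_component_set (closure (int_span (range v))) 0 \<subseteq> \<phi> ` rational_envelope (Rel v)"
  proof
    fix x assume x: "x \<in> connected_component_set (closure (int_span (range v))) 0"
    \<comment> \<open>The choice of the lift \<open>g x\<close> is harmless: two lifts of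
      \<open>x\<close> differ by a relation, and relations lie in \<open>T\<close>.\<close>
    have "g x \<in> T" if T: "rational_subspace T" "Rel v \<subseteq> T" for T
    proof (rule ccontr)
      assume gx: "g x \<notin> T"
      obtain h :: "real ^ 'n \<Rightarrow> real" where h: "linear h" "\<forall>y\<in>T. h y = 0"
          "\<forall>z\<in>integer_points. h z \<in> \<int>" "h (g x) \<noteq> 0"
        by (rule rational_subspace_separation[OF T(1) gx])
      have lin: "linear (h \<circ> g)" using g(1) h(1) by (rule linear_compose)
      then have cont: "continuous_on S (h \<circ> g)" for S
        unfolding linear_conv_bounded_linear by (rule linear_continuous_on)
      have "(h \<circ> g) (\<phi> z) \<in> \<int>" if "z \<in> integer_points" for z
      proof -
        have "g (\<phi> z) - z \<in> T"
          using T(2) by (auto simp: Rel linear_diff[OF \<phi>] g(2))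
        then have "h (g (\<phi> z) - z) = 0" using h(2) by blast
        then show ?thesis using h(3) that by (simp add: linear_diff[OF h(1)])
      qed
      \<comment> \<open>Integrality on the quasilattice passes to its closure because
        \<open>h \<circ> g\<close> is continuous and \<int> is closed.\<close>
      then have "(h \<circ> g) ` closure (int_span (range v)) \<subseteq> \<int>"
        using image_closure_subset[OF cont closed_Ints] unfolding Q by blast
      then have "(h \<circ> g) ` connected_component_set W 0 \<subseteq> \<int>"
        using connected_component_subset[of W 0] unfolding W_def by blast
      moreover have "connected ((h \<circ> g) ` connected_component_set W 0)"
        using cont by (rule connected_continuous_image) simp
      moreover have "0 \<in> connected_component_set W 0"
        using int_mod.subspace_0[OF sub] by simp
      ultimately have "(h \<circ> g) x = (h \<circ> g) 0"
        using x unfolding W_def by (intro connected_subset_Ints_eq) blast+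
      then show False using h(4) linear_0[OF lin] by simp
    qed
    then have "g x \<in> rational_envelope (Rel v)" by (simp add: rational_envelope_def)
    then show "x \<in> \<phi> ` rational_envelope (Rel v)" by (rule rev_image_eqI) (simp add: g(2))
  qed
qed

theorem proposition4p3:
  fixes v :: "'n::finite \<Rightarrow> real ^ 'd::finite"
    and Q :: "(real ^ 'd) set"
  assumes "vector_configuration v"
    and "quasilattice Q"
    and "Q = int_span (range v)"
  shows "int (deg_NR Q) = int (rel_envelope_dim v) - (int CARD('n) - int CARD('d))"
proof -
  define \<phi> where "\<phi> = (\<lambda>c::real ^ 'n. \<Sum>j\<in>UNIV. (c $ j) *\<^sub>R v j)"
  define E where "E = rational_envelope (Rel v)"
  have \<phi>: "linear \<phi>" unfolding \<phi>_def by (rule linear_lincomb)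
  have Rel: "Rel v = {c. \<phi> c = 0}" by (simp add: Rel_def \<phi>_def)
  have surj: "surj \<phi>"
    unfolding \<phi>_def using assms(1) by (rule surj_lincomb)
  then obtain g where g: "linear g" "\<And>y. \<phi> (g y) = y"
    using linear_surjective_right_inverse[OF \<phi>] by (metis comp_apply id_apply)
  have "subspace E"
    unfolding E_def rational_envelope_def rational_subspace_def by (intro subspace_Inter) blast
  moreover have "Rel v \<subseteq> E"
    unfolding E_def rational_envelope_def by blast
  ultimately have "dim E = dim (\<phi> ` E) + dim (Rel v)"
    unfolding Rel by (rule dim_linear_image_kernel[OF \<phi> g])
  \<comment> \<open>The same rank-nullity lemma, now on the whole space, gives the correction term:
    the relations have dimension n - d.\<close>
  moreover have "CARD('n) = CARD('d) + dim (Rel v)"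
    using dim_linear_image_kernel[OF \<phi> g, of UNIV] surj unfolding Rel by simp
  moreover have "deg_NR Q = dim (\<phi> ` E)"
    unfolding deg_NR_def assms(3) component_closure_eq_image[OF assms(1)] \<phi>_def E_def ..
  ultimately show ?thesis
    unfolding rel_envelope_dim_def E_def by simp
qed

end
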